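(* Suppose that $\emptyset\ne\Lambda'\subseteq\mathbb{R}^n$, $\emptyset\ne\Lambda\subseteq\mathbb{R}^n$, $\Lambda+\Lambda'\subseteq\Lambda$, and that $F:\Lambda\times X\to Y$ is Bohr $(\phi,\mathbb{F},\mathcal{B},\Lambda',\rho,\mathcal{P})$-almost periodic (respectively, $(\phi,\mathbb{F},\mathcal{B},\Lambda',\rho,\mathcal{P})$-uniformly recurrent), where $\rho$ is a binary relation on $Y$ such that $R(F)\subseteq D(\rho)$ and $\rho(y)$ is a singleton for every $y\in R(F)$. Suppose that $\tau+\Lambda=\Lambda$ for each $\tau\in\Lambda'$, that $\phi$ is monotonically increasing, that there exists a finite real constant $c>0$ such that $\phi(x+y)\le c[\phi(x)+\phi(y)]$ for all $x,y\ge 0$, and that the following conditions hold: (P) $\mathcal{P}_1=(P_1,d_1)$ is a pseudometric space, $c'\in(0,\infty)$, and for every $f\in P$ and $\tau\in\Lambda'$ we have $f(\cdot-\tau)\in P_1$ and $\|f(\cdot-\tau)\|_{P_1}\le c'\|f\|_P$. (i) $\mathbb{G}:\Lambda\to(0,\infty)$ and $\mathbb{G}(\cdot)\le\inf_{\tau\in\Lambda'}\mathbb{F}(\cdot-\tau)$. (ii) There exists a finite real constant $e>0$ such that the assumptions $f,g\in P$ and $0\le w\le d'[f+g]$ for some finite real constant $d'>0$ imply $w\in P$ and $\|w\|_P\le e(1+d')[\|f\|_P+\|g\|_P]$. (iii) There exists a finite real constant $e_1>0$ such that the assumptions $g\in P_1$ and $0\le f\le g$ imply $\|f\|_{P_1}\le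 e_1\|g\|_{P_1}$. Then $\Lambda+(\Lambda'-\Lambda')\subseteq\Lambda$ and $F$ is Bohr $(\phi,\mathbb{G},\mathcal{B},\Lambda'-\Lambda',\mathrm{I},\mathcal{P}_1)$-almost periodic (respectively, $(\phi,\mathbb{G},\mathcal{B},\Lambda'-\Lambda',\mathrm{I},\mathcal{P}_1)$-uniformly recurrent).
   Context: $X,Y$ are complex Banach spaces, $n\in\mathbb{N}$, $B(\mathbf{t}_0,l)=\{\mathbf{t}\in\mathbb{R}^n:|\mathbf{t}-\mathbf{t}_0|\le l\}$, $\mathrm{I}$ is the identity operator on $Y$, $R(F)$ is the range of $F$, $D(\rho)$ is the domain of $\rho$, $\rho(y)=\{y':(y,y')\in\rho\}$. $\mathcal{B}$ is a non-empty collection of non-empty subsets of $X$ such that every $x\in X$ lies in some $B\in\mathcal{B}$. $\phi:[0,\infty)\to[0,\infty)$ and $\mathbb{F}:\Lambda\to(0,\infty)$. $P$ and $P_1$ are sets of functions $\Lambda\to[0,\infty)$ containing the zero function, and $\mathcal{P}=(P,d)$, $\mathcal{P}_1=(P_1,d_1)$ are pseudometric spaces; $\|f\|_P:=d(f,0)$, $\|f\|_{P_1}:=d_1(f,0)$, and writing $\|f\|_P$ (or $\|f\|_{P_1}$) entails $f\in P$ (or $f\in P_1$). Let $\mathbb{H}:\Lambda\to(0,\infty)$, let $Q$ be a set of functions $\Lambda\to[0,\infty)$ containing the zero function, let $\mathcal{Q}=(Q,d_Q)$ be a pseudometric space, with $\|f\|_Q:=d_Q(f,0)$, where writing $\|f\|_Q$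 entails $f\in Q$, let $\sigma$ be a binary relation on $Y$, and let $\emptyset\ne S\subseteq\mathbb{R}^n$ with $S+\Lambda\subseteq\Lambda$. $F$ is Bohr $(\phi,\mathbb{H},\mathcal{B},S,\sigma,\mathcal{Q})$-almost periodic if for every $B\in\mathcal{B}$ and $\epsilon>0$ there exists $l>0$ such that for each $\mathbf{t}_0\in S$ there exists $\tau\in B(\mathbf{t}_0,l)\cap S$ such that for every $\mathbf{t}\in\Lambda$ and $x\in B$ there is $y_{\mathbf{t};x}\in\sigma(F(\mathbf{t};x))$ with $$\sup_{x\in B}\bigl\|\mathbb{H}(\cdot)\phi(\|F(\cdot+\tau;x)-y_{\cdot;x}\|_Y)\bigr\|_Q\le\epsilon.$$ $F$ is $(\phi,\mathbb{H},\mathcal{B},S,\sigma,\mathcal{Q})$-uniformly recurrent if for every $B\in\mathcal{B}$ there is a sequence $(\tau_k)$ in $S$ with $|\tau_k|\to+\infty$ such that for every $\mathbf{t}\in\Lambda$ and $x\in B$ there is $y_{\mathbf{t};x}\in\sigma(F(\mathbf{t};x))$ with $$\lim_{k\to+\infty}\sup_{x\in B}\bigl\|\mathbb{H}(\cdot)\phi(\|F(\cdot+\tau_k;x)-y_{\cdot;x}\|_Y)\bigr\|_Q=0.$$ *)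

theory Defs
  imports "HOL-Analysis.Analysis" "HOL-Library.Set_Algebras" "HOL-Library.FuncSet"
begin

text \<open>The distribution has no complex Banach spaces.  As usual, such a space is a real Banach space
  whose real scalar multiplication extends to a complex one with the corresponding norm identity.\<close>

class complex_banach = banach +
  fixes scaleC :: "complex \<Rightarrow> 'a \<Rightarrow> 'a"
  assumes scaleR_scaleC: "scaleR r x = scaleC (complex_of_real r) x"
    and scaleC_add_right: "scaleC a (x + y) = scaleC a x + scaleC a y"
    and scaleC_add_left: "scaleC (a + b) x = scaleC a x + scaleC b x"
    and scaleC_scaleC: "scaleC a (scaleC b x) = scaleC (a * b) x"
    and scaleC_one: "scaleC 1 x = x"
    and norm_scaleC: "norm (scaleC a x) = cmod a * norm x"

instantiation complex :: complex_banach
begin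

definition scaleC_complex :: "complex \<Rightarrow> complex \<Rightarrow> complex"
  where "scaleC_complex a x = a * x"

instance
  by standard (simp_all add: scaleC_complex_def scaleR_conv_of_real algebra_simps norm_mult)

end

text \<open>A function from \<open>\<Lambda>\<close> to the nonnegative reals is represented by its extensional extension, an
  element of \<open>\<Lambda> \<rightarrow>\<^sub>E {0..}\<close>, so that equality of functions means equality on \<open>\<Lambda>\<close>.\<close>

definition zero_on :: "'t set \<Rightarrow> 't \<Rightarrow> real"
  where "zero_on \<Lambda> = (\<lambda>t\<in>\<Lambda>. 0)"

definition pseudometric_function_space ::
    "'t set \<Rightarrow> ('t \<Rightarrow> real) set \<Rightarrow> (('t \<Rightarrow> real) \<Rightarrow> ('t \<Rightarrow> real) \<Rightarrow> real) \<Rightarrow> bool"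
  where "pseudometric_function_space \<Lambda> P d \<longleftrightarrow>
    P \<subseteq> (\<Lambda> \<rightarrow>\<^sub>E {0..}) \<and> zero_on \<Lambda> \<in> P \<and>
    (\<forall>f\<in>P. \<forall>g\<in>P. 0 \<le> d f g) \<and>
    (\<forall>f\<in>P. d f f = 0) \<and>
    (\<forall>f\<in>P. \<forall>g\<in>P. d f g = d g f) \<and>
    (\<forall>f\<in>P. \<forall>g\<in>P. \<forall>h\<in>P. d f h \<le> d f g + d g h)"

text \<open>Meaningful only for \<open>f \<in> P\<close>; membership is always stated alongside it below.\<close>

definition pnorm :: "'t set \<Rightarrow> (('t \<Rightarrow> real) \<Rightarrow> ('t \<Rightarrow> real) \<Rightarrow> real) \<Rightarrow> ('t \<Rightarrow> real) \<Rightarrow> real"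
  where "pnorm \<Lambda> d f = d f (zero_on \<Lambda>)"

definition differences :: "'a::ab_group_add set \<Rightarrow> 'a set"
  where "differences A = {a - b | a b. a \<in> A \<and> b \<in> A}"

definition weighted_deviation ::
    "'t::plus set \<Rightarrow> (real \<Rightarrow> real) \<Rightarrow> ('t \<Rightarrow> real) \<Rightarrow> ('t \<Rightarrow> 'x \<Rightarrow> 'y::real_normed_vector) \<Rightarrow>
     ('t \<Rightarrow> 'x \<Rightarrow> 'y) \<Rightarrow> 't \<Rightarrow> 'x \<Rightarrow> 't \<Rightarrow> real"
  where "weighted_deviation \<Lambda> \<phi> \<H> F y \<tau> x = (\<lambda>t\<in>\<Lambda>. \<H> t * \<phi> (norm (F (t + \<tau>) x - y t x)))"

text \<open>Suprema are taken in the extended reals, so that the supremum of an unbounded family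
  is infinite.  The selection \<open>y\<close> may depend on \<open>\<tau>\<close> in the first definition, but in the second
  one it is common to all terms of the sequence.\<close>

definition bohr_almost_periodic ::
    "(real^'n) set \<Rightarrow> (real \<Rightarrow> real) \<Rightarrow> (real^'n \<Rightarrow> real) \<Rightarrow> 'x set set \<Rightarrow> (real^'n) set \<Rightarrow>
     ('y \<times> 'y) set \<Rightarrow> (real^'n \<Rightarrow> real) set \<Rightarrow> ((real^'n \<Rightarrow> real) \<Rightarrow> (real^'n \<Rightarrow> real) \<Rightarrow> real) \<Rightarrow>
     (real^'n \<Rightarrow> 'x::complex_banach \<Rightarrow> 'y::complex_banach) \<Rightarrow> bool"
  where "bohr_almost_periodic \<Lambda> \<phi> \<H> \<B> S \<sigma> Q d F \<longleftrightarrow>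
    (\<forall>B\<in>\<B>. \<forall>\<epsilon>>0. \<exists>l>0. \<forall>t\<^sub>0\<in>S. \<exists>\<tau> \<in> cball t\<^sub>0 l \<inter> S. \<exists>y.
      (\<forall>t\<in>\<Lambda>. \<forall>x\<in>B. y t x \<in> \<sigma> `` {F t x}) \<and>
      (\<forall>x\<in>B. weighted_deviation \<Lambda> \<phi> \<H> F y \<tau> x \<in> Q) \<and>
      (SUP x\<in>B. ereal (pnorm \<Lambda> d (weighted_deviation \<Lambda> \<phi> \<H> F y \<tau> x))) \<le> ereal \<epsilon>)"

definition uniformly_recurrent ::
    "(real^'n) set \<Rightarrow> (real \<Rightarrow> real) \<Rightarrow> (real^'n \<Rightarrow> real) \<Rightarrow> 'x set set \<Rightarrow> (real^'n) set \<Rightarrow>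
     ('y \<times> 'y) set \<Rightarrow> (real^'n \<Rightarrow> real) set \<Rightarrow> ((real^'n \<Rightarrow> real) \<Rightarrow> (real^'n \<Rightarrow> real) \<Rightarrow> real) \<Rightarrow>
     (real^'n \<Rightarrow> 'x::complex_banach \<Rightarrow> 'y::complex_banach) \<Rightarrow> bool"
  where "uniformly_recurrent \<Lambda> \<phi> \<H> \<B> S \<sigma> Q d F \<longleftrightarrow>
    (\<forall>B\<in>\<B>. \<exists>\<tau> :: nat \<Rightarrow> real^'n.
      (\<forall>k. \<tau> k \<in> S) \<and> filterlim (\<lambda>k. norm (\<tau> k)) at_top sequentially \<and>
      (\<exists>y. (\<forall>t\<in>\<Lambda>. \<forall>x\<in>B. y t x \<in> \<sigma> `` {F t x}) \<and>
        (\<forall>k. \<forall>x\<in>B. weighted_deviation \<Lambda> \<phi> \<H> F y (\<tau> k) x \<in> Q) \<and>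
        (\<lambda>k. SUP x\<in>B. ereal (pnorm \<Lambda> d (weighted_deviation \<Lambda> \<phi> \<H> F y (\<tau> k) x)))
          \<longlonglongrightarrow> 0))"

end

theory Submission
  imports Defs
begin

text \<open>For \<open>\<tau>\<^sub>1, \<tau>\<^sub>2 \<in> \<Lambda>'\<close> put \<open>s = t - \<tau>\<^sub>2\<close>, which again runs through \<open>\<Lambda>\<close>.  Then
  \<open>F (t + (\<tau>\<^sub>1 - \<tau>\<^sub>2)) - F t = (F (s + \<tau>\<^sub>1) - y s) - (F (s + \<tau>\<^sub>2) - y s)\<close>, where \<open>y s\<close> is the unique
  element of \<open>\<rho> (F s)\<close>, so the deviation of \<open>\<tau>\<^sub>1 - \<tau>\<^sub>2\<close> from the identity is controlled by the
  translate by \<open>\<tau>\<^sub>2\<close> of the deviations of \<open>\<tau>\<^sub>1\<close> and \<open>\<tau>\<^sub>2\<close> from \<open>\<rho>\<close>.  Almost periods of \<open>F\<close> near \<open>a\<close> and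
  \<open>b\<close> thus give one near \<open>a - b\<close>, and a recurrence sequence \<open>\<tau>\<close> gives \<open>\<tau> (m k) - \<tau> k\<close>, with \<open>m k\<close> so
  large that the norms still diverge.\<close>

section \<open>Sets invariant under translation\<close>

lemma mem_elt_set_plus_self_iff:
  fixes \<tau> :: "'a::ab_group_add"
  assumes "\<tau> +o A = A"
  shows "t - \<tau> \<in> A \<longleftrightarrow> t \<in> A"
proof
  assume "t - \<tau> \<in> A"
  then have "\<tau> + (t - \<tau>) \<in> \<tau> +o A" by (rule set_plus_intro2)
  with assms show "t \<in> A" by simp
next
  assume "t \<in> A"
  then have "t \<in> \<tau> +o A" by (simp add: assms)
  then obtain a where "a \<in> A" "t = \<tau> + a" by (auto simp: elt_set_plus_def)
  then show "t - \<tau> \<in> A" by simp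
qed

text \<open>The equality \<open>\<tau> +o A = A\<close> lets one subtract elements of T as well as
  add them. So t - b stays in A, and adding a to it stays in A too. A mere inclusion of
  \<open>\<tau> +o A\<close> in A would not permit the first move.\<close>

lemma plus_differences_subset:
  fixes A T :: "'a::ab_group_add set"
  assumes "\<And>\<tau>. \<tau> \<in> T \<Longrightarrow> \<tau> +o A = A"
  shows "A + differences T \<subseteq> A"
proof
  fix z assume "z \<in> A + differences T"
  then obtain t a b where "t \<in> A" "a \<in> T" "b \<in> T" and z: "z = t + (a - b)"
    by (auto simp: differences_def elim!: set_plus_elim)
  then have "t - b \<in> A" using mem_elt_set_plus_self_iff[OF assms] by blast
  moreover have "z - a = t - b" by (simp add: z algebra_simps)
  ultimately show "z \<in> A"
    using mem_elt_set_plus_self_iff[OF assms[OF \<open>a \<in> T\<close>], of z] by simp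
qed

section \<open>Estimating the deviation of a difference of two translations\<close>

lemma quasi_subadditive_norm_diff:
  fixes \<phi> :: "real \<Rightarrow> real" and u v y :: "'a::real_normed_vector"
  assumes "mono_on {0..} \<phi>"
    and "\<And>a b. 0 \<le> a \<Longrightarrow> 0 \<le> b \<Longrightarrow> \<phi> (a + b) \<le> c * (\<phi> a + \<phi> b)"
  shows "\<phi> (norm (u - v)) \<le> c * (\<phi> (norm (u - y)) + \<phi> (norm (v - y)))"
proof -
  have "norm (u - v) \<le> norm (u - y) + norm (v - y)"
    using norm_triangle_ineq4[of "u - y" "v - y"] by simp
  then have "\<phi> (norm (u - v)) \<le> \<phi> (norm (u - y) + norm (v - y))"
    by (intro mono_onD[OF assms(1)]) auto
  also have "\<dots> \<le> c * (\<phi> (norm (u - y)) + \<phi> (norm (v - y)))"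
    by (intro assms(2)) auto
  finally show ?thesis .
qed

lemma pnorm_nonneg:
  "pseudometric_function_space \<Lambda> P d \<Longrightarrow> f \<in> P \<Longrightarrow> 0 \<le> pnorm \<Lambda> d f"
  by (auto simp: pseudometric_function_space_def pnorm_def)

lemma weighted_deviation_nonneg:
  assumes "\<And>a. 0 \<le> a \<Longrightarrow> 0 \<le> \<phi> a" "\<And>t. t \<in> \<Lambda> \<Longrightarrow> 0 < \<H> t"
  shows "weighted_deviation \<Lambda> \<phi> \<H> F y \<tau> x \<in> \<Lambda> \<rightarrow>\<^sub>E {0..}"
  by (auto simp: weighted_deviation_def assms(1) less_imp_le[OF assms(2)])

text \<open>The common value of the selections at s = t - \<open>\<tau>\<^sub>2\<close> serves as
  the middle point of the triangle inequality. Two selections are allowed because in the Bohr case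
  they depend on the almost period; agreement at s is enough. Replacing the weight at t by the one
  at s makes the right-hand side a function translated by \<open>\<tau>\<^sub>2\<close>, the form
  that condition (P) treats.\<close>

lemma weighted_deviation_difference_le:
  fixes F :: "'t::ab_group_add \<Rightarrow> 'x \<Rightarrow> 'y::real_normed_vector"
  assumes phi: "mono_on {0..} \<phi>" "\<And>a. 0 \<le> a \<Longrightarrow> 0 \<le> \<phi> a"
    and quasi: "\<And>a b. 0 \<le> a \<Longrightarrow> 0 \<le> b \<Longrightarrow> \<phi> (a + b) \<le> c * (\<phi> a + \<phi> b)"
    and t: "t \<in> \<Lambda>" "t - \<tau>\<^sub>2 \<in> \<Lambda>"
    and weight: "0 < \<G> t" "\<G> t \<le> \<F> (t - \<tau>\<^sub>2)"
    and y: "y\<^sub>1 (t - \<tau>\<^sub>2) x = y\<^sub>2 (t - \<tau>\<^sub>2) x"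
  shows "weighted_deviation \<Lambda> \<phi> \<G> F F (\<tau>\<^sub>1 - \<tau>\<^sub>2) x t \<le>
    c * (weighted_deviation \<Lambda> \<phi> \<F> F y\<^sub>1 \<tau>\<^sub>1 x (t - \<tau>\<^sub>2) +
         weighted_deviation \<Lambda> \<phi> \<F> F y\<^sub>2 \<tau>\<^sub>2 x (t - \<tau>\<^sub>2))"
proof -
  let ?s = "t - \<tau>\<^sub>2" and ?N = "norm (F (t + (\<tau>\<^sub>1 - \<tau>\<^sub>2)) x - F t x)"
  have "\<phi> ?N \<le> c * (\<phi> (norm (F (?s + \<tau>\<^sub>1) x - y\<^sub>1 ?s x)) + \<phi> (norm (F (?s + \<tau>\<^sub>2) x - y\<^sub>2 ?s x)))"
    using quasi_subadditive_norm_diff[of \<phi> c "F (?s + \<tau>\<^sub>1) x" "F (?s + \<tau>\<^sub>2) x" "y\<^sub>1 ?s x"]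
      phi(1) quasi y by (simp add: algebra_simps)
  then have "\<F> ?s * \<phi> ?N \<le> \<F> ?s *
      (c * (\<phi> (norm (F (?s + \<tau>\<^sub>1) x - y\<^sub>1 ?s x)) + \<phi> (norm (F (?s + \<tau>\<^sub>2) x - y\<^sub>2 ?s x))))"
    using weight by (intro mult_left_mono) auto
  moreover have "\<G> t * \<phi> ?N \<le> \<F> ?s * \<phi> ?N"
    using weight(2) by (intro mult_right_mono phi(2)) auto
  ultimately show ?thesis
    using t by (simp add: weighted_deviation_def distrib_left mult.left_commute)
qed

text \<open>The three conditions are chained: (ii) with d' = c puts c(f + g) into P, (P) moves its
  translate into \<open>P\<^sub>1\<close>, and (iii) passes from this translate down to h. The
  constant is the product of the factors \<open>e * (1 + c)\<close>, c' and \<open>e\<^sub>1\<close>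
  from these three moves. The sum is formed before translating because (ii) concerns P, not
  \<open>P\<^sub>1\<close>.\<close>

lemma pnorm_translated_majorant:
  fixes f g h :: "'t::ab_group_add \<Rightarrow> real"
  assumes space: "P \<subseteq> \<Lambda> \<rightarrow>\<^sub>E {0..}"
    and pos: "0 < c" "0 < c'" "0 < e\<^sub>1"
    and translate: "\<And>u. u \<in> P \<Longrightarrow>
        (\<lambda>t\<in>\<Lambda>. u (t - \<tau>)) \<in> P\<^sub>1 \<and> pnorm \<Lambda> d\<^sub>1 (\<lambda>t\<in>\<Lambda>. u (t - \<tau>)) \<le> c' * pnorm \<Lambda> d u"
    and dominated: "\<forall>f\<in>P. \<forall>g\<in>P. \<forall>w\<in>\<Lambda> \<rightarrow>\<^sub>E {0..}. \<forall>d'>0.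
        (\<forall>t\<in>\<Lambda>. w t \<le> d' * (f t + g t)) \<longrightarrow>
        w \<in> P \<and> pnorm \<Lambda> d w \<le> e * (1 + d') * (pnorm \<Lambda> d f + pnorm \<Lambda> d g)"
    and monotone: "\<forall>g\<in>P\<^sub>1. \<forall>f\<in>\<Lambda> \<rightarrow>\<^sub>E {0..}. (\<forall>t\<in>\<Lambda>. f t \<le> g t) \<longrightarrow>
        f \<in> P\<^sub>1 \<and> pnorm \<Lambda> d\<^sub>1 f \<le> e\<^sub>1 * pnorm \<Lambda> d\<^sub>1 g"
    and shift: "\<And>t. t \<in> \<Lambda> \<Longrightarrow> t - \<tau> \<in> \<Lambda>"
    and fg: "f \<in> P" "g \<in> P"
    and h: "h \<in> \<Lambda> \<rightarrow>\<^sub>E {0..}" "\<And>t. t \<in> \<Lambda> \<Longrightarrow> h t \<le> c * (f (t - \<tau>) + g (t - \<tau>))"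
  shows "h \<in> P\<^sub>1 \<and> pnorm \<Lambda> d\<^sub>1 h \<le> e\<^sub>1 * c' * e * (1 + c) * (pnorm \<Lambda> d f + pnorm \<Lambda> d g)"
proof -
  define w where "w = (\<lambda>t\<in>\<Lambda>. c * (f t + g t))"
  define v where "v = (\<lambda>t\<in>\<Lambda>. w (t - \<tau>))"
  have "f \<in> \<Lambda> \<rightarrow>\<^sub>E {0..}" "g \<in> \<Lambda> \<rightarrow>\<^sub>E {0..}" using space fg by auto
  then have "0 \<le> f t" "0 \<le> g t" if "t \<in> \<Lambda>" for t
    using that by (auto dest: PiE_mem)
  then have "w \<in> \<Lambda> \<rightarrow>\<^sub>E {0..}" using pos(1) by (auto simp: w_def)
  then have w: "w \<in> P" "pnorm \<Lambda> d w \<le> e * (1 + c) * (pnorm \<Lambda> d f + pnorm \<Lambda> d g)"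
    using bspec[OF bspec[OF bspec[OF dominated fg(1)] fg(2)], of w] pos(1) by (auto simp: w_def)
  have v: "v \<in> P\<^sub>1" "pnorm \<Lambda> d\<^sub>1 v \<le> c' * pnorm \<Lambda> d w"
    using translate[OF w(1)] by (auto simp: v_def)
  \<comment> \<open>Restricted functions are \<open>undefined\<close> off \<Lambda>, so
    \<open>w (t - \<tau>)\<close> unfolds to the intended sum only because \<open>shift\<close>
    keeps the argument inside \<Lambda>.\<close>
  have "\<forall>t\<in>\<Lambda>. h t \<le> v t" using h(2) shift by (simp add: v_def w_def)
  with monotone v(1) h(1) have hP: "h \<in> P\<^sub>1" "pnorm \<Lambda> d\<^sub>1 h \<le> e\<^sub>1 * pnorm \<Lambda> d\<^sub>1 v" by blast+
  note hP(2)
  also have "e\<^sub>1 * pnorm \<Lambda> d\<^sub>1 v \<le> e\<^sub>1 * (c' * pnorm \<Lambda> d w)"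
    using v(2) pos by (intro mult_left_mono) auto
  also have "\<dots> \<le> e\<^sub>1 * (c' * (e * (1 + c) * (pnorm \<Lambda> d f + pnorm \<Lambda> d g)))"
    using w(2) pos by (intro mult_left_mono) auto
  finally show ?thesis using hP(1) by (simp add: mult.assoc)
qed

section \<open>Differences of translation vectors, and limits of suprema\<close>

lemma differences_near:
  fixes A :: "'a::real_normed_vector set"
  assumes "a \<in> A" "b \<in> A" "a' \<in> cball a l \<inter> A" "b' \<in> cball b l \<inter> A"
  shows "a' - b' \<in> cball (a - b) (2 * l) \<inter> differences A"
proof -
  have "dist (a - b) (a' - b') \<le> dist a a' + dist b b'"
    using norm_triangle_ineq4[of "a - a'" "b - b'"] by (simp add: dist_norm algebra_simps)
  then show ?thesis using assms by (auto simp: differences_def)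
qed

text \<open>Nonnegative terms can approach 0 only from above, and an upper bound on the supremum is
  a bound common to all x. This trades a limit in \<open>ereal\<close> for real estimates uniform in
  x. For empty B the supremum would be -\<infinity> and the limit would fail.\<close>

lemma SUP_ereal_tendsto_0_iff:
  fixes p :: "nat \<Rightarrow> 'a \<Rightarrow> real"
  assumes "B \<noteq> {}" "\<And>k x. x \<in> B \<Longrightarrow> 0 \<le> p k x"
  shows "(\<lambda>k. SUP x\<in>B. ereal (p k x)) \<longlonglongrightarrow> 0 \<longleftrightarrow>
    (\<forall>\<epsilon>>0. \<exists>N. \<forall>k\<ge>N. \<forall>x\<in>B. p k x \<le> \<epsilon>)"
    (is "?S \<longlonglongrightarrow> 0 \<longleftrightarrow> ?R")
proof
  assume lim: "?S \<longlonglongrightarrow> 0"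
  show ?R
  proof (intro allI impI)
    fix \<epsilon> :: real assume "0 < \<epsilon>"
    then have "\<forall>\<^sub>F k in sequentially. ?S k < ereal \<epsilon>"
      by (intro order_tendstoD(2)[OF lim]) simp
    then obtain N where "\<And>k. k \<ge> N \<Longrightarrow> ?S k < ereal \<epsilon>" by (auto simp: eventually_sequentially)
    moreover have "ereal (p k x) \<le> ?S k" if "x \<in> B" for k x using that by (rule SUP_upper)
    ultimately show "\<exists>N. \<forall>k\<ge>N. \<forall>x\<in>B. p k x \<le> \<epsilon>"
      by (metis ereal_less_eq(3) le_less_trans less_imp_le)
  qed
next
  assume R: ?R
  obtain x\<^sub>0 where "x\<^sub>0 \<in> B" using assms(1) by blast
  have nonneg: "0 \<le> ?S k" for k
    by (rule SUP_upper2[OF \<open>x\<^sub>0 \<in> B\<close>]) (simp add: assms(2) \<open>x\<^sub>0 \<in> B\<close>)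
  show "?S \<longlonglongrightarrow> 0"
  proof (rule order_tendstoI)
    fix a :: ereal assume "a < 0"
    then show "\<forall>\<^sub>F k in sequentially. a < ?S k" using less_le_trans[OF _ nonneg] by simp
  next
    fix a :: ereal assume "0 < a"
    \<comment> \<open>As a may be infinite, a real number strictly below it is chosen; the gap turns
      the weak bound on the supremum into the strict one required.\<close>
    then obtain \<epsilon> where \<epsilon>: "0 < ereal \<epsilon>" "ereal \<epsilon> < a" using ereal_dense2 by blast
    with R obtain N where N: "\<forall>k\<ge>N. \<forall>x\<in>B. p k x \<le> \<epsilon>" by auto
    have "?S k < a" if "k \<ge> N" for k
    proof -
      have "?S k \<le> ereal \<epsilon>" using N that by (intro SUP_least) simp
      then show ?thesis using \<epsilon>(2) by (rule le_less_trans)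
    qed
    then show "\<forall>\<^sub>F k in sequentially. ?S k < a" by (auto simp: eventually_sequentially)
  qed
qed

text \<open>Consecutive differences of a divergent sequence can stay bounded, so the partner index
  skips ahead until its norm exceeds that of \<open>\<tau> k\<close> by at least k; the reverse
  triangle inequality does the rest. The bound \<open>k \<le> m k\<close> carries estimates valid
  from some index on over to the index \<open>m k\<close>.\<close>

lemma divergent_differences:
  fixes \<tau> :: "nat \<Rightarrow> 'a::real_normed_vector"
  assumes "filterlim (\<lambda>k. norm (\<tau> k)) at_top sequentially"
  obtains m where "\<And>k. k \<le> m k" "filterlim (\<lambda>k. norm (\<tau> (m k) - \<tau> k)) at_top sequentially"
proof -
  have "\<exists>j\<ge>k. norm (\<tau> k) + real k \<le> norm (\<tau> j)" for k
  proof -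
    have "\<forall>\<^sub>F j in sequentially. norm (\<tau> k) + real k \<le> norm (\<tau> j)"
      using assms by (simp add: filterlim_at_top)
    then have "\<forall>\<^sub>F j in sequentially. k \<le> j \<and> norm (\<tau> k) + real k \<le> norm (\<tau> j)"
      using eventually_ge_at_top by (rule eventually_conj[rotated])
    then show ?thesis using eventually_happens'[OF sequentially_bot] by blast
  qed
  then obtain m where m: "\<And>k. k \<le> m k \<and> norm (\<tau> k) + real k \<le> norm (\<tau> (m k))"
    using choice[of "\<lambda>k j. k \<le> j \<and> norm (\<tau> k) + real k \<le> norm (\<tau> j)"] by blast
  have "real k \<le> norm (\<tau> (m k) - \<tau> k)" for k
    using m[of k] norm_triangle_ineq2[of "\<tau> (m k)" "\<tau> k"] by linarith
  then have "filterlim (\<lambda>k. norm (\<tau> (m k) - \<tau> k)) at_top sequentially"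
    by (intro filterlim_at_top_mono[OF filterlim_real_sequentially]) auto
  with m show ?thesis by (intro that[of m]) auto
qed

section \<open>Almost periods and recurrence sequences in the difference set\<close>

theorem proposition2p9:
  fixes \<Lambda> \<Lambda>' :: "(real^'n) set"
    and F :: "real^'n \<Rightarrow> 'x::complex_banach \<Rightarrow> 'y::complex_banach"
    and \<phi> :: "real \<Rightarrow> real"
    and \<F> \<G> :: "real^'n \<Rightarrow> real"
    and \<B> :: "'x set set"
    and \<rho> :: "('y \<times> 'y) set"
    and P P\<^sub>1 :: "(real^'n \<Rightarrow> real) set"
    and d d\<^sub>1 :: "(real^'n \<Rightarrow> real) \<Rightarrow> (real^'n \<Rightarrow> real) \<Rightarrow> real"
    and c' :: real
  assumes family: "\<B> \<noteq> {}" "\<And>B. B \<in> \<B> \<Longrightarrow> B \<noteq> {}" "\<And>x. \<exists>B\<in>\<B>. x \<in> B"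
    and phi_nonneg: "\<And>x. 0 \<le> x \<Longrightarrow> 0 \<le> \<phi> x"
    and F_weight_pos: "\<And>t. t \<in> \<Lambda> \<Longrightarrow> 0 < \<F> t"
    and space_P: "pseudometric_function_space \<Lambda> P d"
    and nonempty: "\<Lambda>' \<noteq> {}" "\<Lambda> \<noteq> {}"
    and translate: "\<Lambda> + \<Lambda>' \<subseteq> \<Lambda>"
    and rho_domain: "(\<Union>t\<in>\<Lambda>. range (F t)) \<subseteq> Domain \<rho>"
    and rho_singleton: "\<And>z. z \<in> (\<Union>t\<in>\<Lambda>. range (F t)) \<Longrightarrow> is_singleton (\<rho> `` {z})"
    and translate_eq: "\<And>\<tau>. \<tau> \<in> \<Lambda>' \<Longrightarrow> \<tau> +o \<Lambda> = \<Lambda>"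
    and phi_mono: "mono_on {0..} \<phi>"
    and phi_quasi_subadditive: "\<exists>c>0. \<forall>x\<ge>0. \<forall>y\<ge>0. \<phi> (x + y) \<le> c * (\<phi> x + \<phi> y)"
    and cond_P: "pseudometric_function_space \<Lambda> P\<^sub>1 d\<^sub>1" "0 < c'"
      "\<And>f \<tau>. f \<in> P \<Longrightarrow> \<tau> \<in> \<Lambda>' \<Longrightarrow>
        (\<lambda>t\<in>\<Lambda>. f (t - \<tau>)) \<in> P\<^sub>1 \<and>
        pnorm \<Lambda> d\<^sub>1 (\<lambda>t\<in>\<Lambda>. f (t - \<tau>)) \<le> c' * pnorm \<Lambda> d f"
    and cond_i: "\<And>t. t \<in> \<Lambda> \<Longrightarrow> 0 < \<G> t"
      "\<And>t. t \<in> \<Lambda> \<Longrightarrow> \<G> t \<le> (INF \<tau>\<in>\<Lambda>'. \<F> (t - \<tau>))"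
    and cond_ii: "\<exists>e>0. \<forall>f\<in>P. \<forall>g\<in>P. \<forall>w\<in>\<Lambda> \<rightarrow>\<^sub>E {0..}. \<forall>d'>0.
        (\<forall>t\<in>\<Lambda>. w t \<le> d' * (f t + g t)) \<longrightarrow>
        w \<in> P \<and> pnorm \<Lambda> d w \<le> e * (1 + d') * (pnorm \<Lambda> d f + pnorm \<Lambda> d g)"
    and cond_iii: "\<exists>e\<^sub>1>0. \<forall>g\<in>P\<^sub>1. \<forall>f\<in>\<Lambda> \<rightarrow>\<^sub>E {0..}.
        (\<forall>t\<in>\<Lambda>. f t \<le> g t) \<longrightarrow>
        f \<in> P\<^sub>1 \<and> pnorm \<Lambda> d\<^sub>1 f \<le> e\<^sub>1 * pnorm \<Lambda> d\<^sub>1 g"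
  shows "(bohr_almost_periodic \<Lambda> \<phi> \<F> \<B> \<Lambda>' \<rho> P d F \<longrightarrow>
            \<Lambda> + differences \<Lambda>' \<subseteq> \<Lambda> \<and>
            bohr_almost_periodic \<Lambda> \<phi> \<G> \<B> (differences \<Lambda>') Id P\<^sub>1 d\<^sub>1 F) \<and>
         (uniformly_recurrent \<Lambda> \<phi> \<F> \<B> \<Lambda>' \<rho> P d F \<longrightarrow>
            \<Lambda> + differences \<Lambda>' \<subseteq> \<Lambda> \<and>
            uniformly_recurrent \<Lambda> \<phi> \<G> \<B> (differences \<Lambda>') Id P\<^sub>1 d\<^sub>1 F)"
proof -
  obtain c where c: "0 < c" "\<And>a b. 0 \<le> a \<Longrightarrow> 0 \<le> b \<Longrightarrow> \<phi> (a + b) \<le> c * (\<phi> a + \<phi> b)"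
    using phi_quasi_subadditive by blast
  obtain e where e: "0 < e" "\<forall>f\<in>P. \<forall>g\<in>P. \<forall>w\<in>\<Lambda> \<rightarrow>\<^sub>E {0..}. \<forall>d'>0.
        (\<forall>t\<in>\<Lambda>. w t \<le> d' * (f t + g t)) \<longrightarrow>
        w \<in> P \<and> pnorm \<Lambda> d w \<le> e * (1 + d') * (pnorm \<Lambda> d f + pnorm \<Lambda> d g)"
    using cond_ii by (elim exE conjE) (rule that)
  obtain e\<^sub>1 where e\<^sub>1: "0 < e\<^sub>1" "\<forall>g\<in>P\<^sub>1. \<forall>f\<in>\<Lambda> \<rightarrow>\<^sub>E {0..}. (\<forall>t\<in>\<Lambda>. f t \<le> g t) \<longrightarrow>
        f \<in> P\<^sub>1 \<and> pnorm \<Lambda> d\<^sub>1 f \<le> e\<^sub>1 * pnorm \<Lambda> d\<^sub>1 g"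
    using cond_iii by (elim exE conjE) (rule that)
  \<comment> \<open>This is the constant of \<open>pnorm_translated_majorant\<close>; it depends on
    neither the translations nor x, so one choice serves all of B.\<close>
  define K where "K = e\<^sub>1 * c' * e * (1 + c)"
  have K: "0 < K" using c(1) e(1) e\<^sub>1(1) cond_P(2) by (simp add: K_def)
  note shift = iffD2[OF mem_elt_set_plus_self_iff[OF translate_eq]]
  have weight: "\<G> t \<le> \<F> (t - \<tau>)" if "t \<in> \<Lambda>" "\<tau> \<in> \<Lambda>'" for t \<tau>
  proof -
    \<comment> \<open>A real \<open>INF\<close> is a lower bound only for a family bounded below.
      Here 0 bounds it, since t - \<tau> stays in \<Lambda>, where \<F> is positive.\<close>
    have "bdd_below ((\<lambda>\<tau>. \<F> (t - \<tau>)) ` \<Lambda>')"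
      using F_weight_pos shift that(1) by (intro bdd_belowI2[of _ 0]) (auto intro: less_imp_le)
    then show ?thesis by (rule order_trans[OF cond_i(2)[OF that(1)] cINF_lower[OF _ that(2)]])
  qed
  have key: "weighted_deviation \<Lambda> \<phi> \<G> F F (\<tau>\<^sub>1 - \<tau>\<^sub>2) x \<in> P\<^sub>1 \<and>
      pnorm \<Lambda> d\<^sub>1 (weighted_deviation \<Lambda> \<phi> \<G> F F (\<tau>\<^sub>1 - \<tau>\<^sub>2) x) \<le>
        K * (pnorm \<Lambda> d (weighted_deviation \<Lambda> \<phi> \<F> F y\<^sub>1 \<tau>\<^sub>1 x) +
             pnorm \<Lambda> d (weighted_deviation \<Lambda> \<phi> \<F> F y\<^sub>2 \<tau>\<^sub>2 x))"
    if \<tau>: "\<tau>\<^sub>1 \<in> \<Lambda>'" "\<tau>\<^sub>2 \<in> \<Lambda>'"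
      and y: "\<forall>t\<in>\<Lambda>. y\<^sub>1 t x \<in> \<rho> `` {F t x}" "\<forall>t\<in>\<Lambda>. y\<^sub>2 t x \<in> \<rho> `` {F t x}"
      and mem: "weighted_deviation \<Lambda> \<phi> \<F> F y\<^sub>1 \<tau>\<^sub>1 x \<in> P" "weighted_deviation \<Lambda> \<phi> \<F> F y\<^sub>2 \<tau>\<^sub>2 x \<in> P"
    for \<tau>\<^sub>1 \<tau>\<^sub>2 x and y\<^sub>1 y\<^sub>2 :: "real^'n \<Rightarrow> 'x \<Rightarrow> 'y"
    unfolding K_def
  proof (rule pnorm_translated_majorant[OF _ c(1) cond_P(2) e\<^sub>1(1) cond_P(3)[OF _ \<tau>(2)] e(2) e\<^sub>1(2)
        shift[OF \<tau>(2)] mem])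
    show "P \<subseteq> \<Lambda> \<rightarrow>\<^sub>E {0..}" using space_P by (simp add: pseudometric_function_space_def)
    show "weighted_deviation \<Lambda> \<phi> \<G> F F (\<tau>\<^sub>1 - \<tau>\<^sub>2) x \<in> \<Lambda> \<rightarrow>\<^sub>E {0..}"
      using phi_nonneg cond_i(1) by (rule weighted_deviation_nonneg)
    fix t assume t: "t \<in> \<Lambda>"
    have s: "t - \<tau>\<^sub>2 \<in> \<Lambda>" using shift[OF \<tau>(2) t] .
    \<comment> \<open>Both selections at \<open>t - \<tau>\<^sub>2\<close> lie in the same set;
      being a singleton, it forces them to agree.\<close>
    then have "is_singleton (\<rho> `` {F (t - \<tau>\<^sub>2) x})" by (intro rho_singleton) auto
    then have "y\<^sub>1 (t - \<tau>\<^sub>2) x = y\<^sub>2 (t - \<tau>\<^sub>2) x"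
      using y s by (metis is_singletonE singletonD)
    then show "weighted_deviation \<Lambda> \<phi> \<G> F F (\<tau>\<^sub>1 - \<tau>\<^sub>2) x t \<le>
        c * (weighted_deviation \<Lambda> \<phi> \<F> F y\<^sub>1 \<tau>\<^sub>1 x (t - \<tau>\<^sub>2) +
             weighted_deviation \<Lambda> \<phi> \<F> F y\<^sub>2 \<tau>\<^sub>2 x (t - \<tau>\<^sub>2))"
      using phi_mono phi_nonneg c(2) t s cond_i(1)[OF t] weight[OF t \<tau>(2)]
      by (intro weighted_deviation_difference_le)
  qed auto
  have bohr: "bohr_almost_periodic \<Lambda> \<phi> \<G> \<B> (differences \<Lambda>') Id P\<^sub>1 d\<^sub>1 F"
    if ap: "bohr_almost_periodic \<Lambda> \<phi> \<F> \<B> \<Lambda>' \<rho> P d F"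
    unfolding bohr_almost_periodic_def
  proof (intro ballI allI impI)
    fix B and \<epsilon> :: real assume B: "B \<in> \<B>" and "0 < \<epsilon>"
    \<comment> \<open>Two deviations of size \<delta> are added and multiplied by K, and K(\<delta>
      + \<delta>) = \<epsilon>.\<close>
    define \<delta> where "\<delta> = \<epsilon> / (2 * K)"
    have "0 < \<delta>" using \<open>0 < \<epsilon>\<close> K by (simp add: \<delta>_def)
    from ap[unfolded bohr_almost_periodic_def, rule_format, OF B this]
    obtain l where "0 < l" and l: "\<forall>a\<in>\<Lambda>'. \<exists>\<tau> \<in> cball a l \<inter> \<Lambda>'. \<exists>y.
        (\<forall>t\<in>\<Lambda>. \<forall>x\<in>B. y t x \<in> \<rho> `` {F t x}) \<and>
        (\<forall>x\<in>B. weighted_deviation \<Lambda> \<phi> \<F> F y \<tau> x \<in> P) \<and>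
        (SUP x\<in>B. ereal (pnorm \<Lambda> d (weighted_deviation \<Lambda> \<phi> \<F> F y \<tau> x))) \<le> ereal \<delta>"
      by (elim exE conjE) (rule that)
    show "\<exists>l>0. \<forall>t\<^sub>0\<in>differences \<Lambda>'. \<exists>\<tau> \<in> cball t\<^sub>0 l \<inter> differences \<Lambda>'. \<exists>y.
        (\<forall>t\<in>\<Lambda>. \<forall>x\<in>B. y t x \<in> Id `` {F t x}) \<and>
        (\<forall>x\<in>B. weighted_deviation \<Lambda> \<phi> \<G> F y \<tau> x \<in> P\<^sub>1) \<and>
        (SUP x\<in>B. ereal (pnorm \<Lambda> d\<^sub>1 (weighted_deviation \<Lambda> \<phi> \<G> F y \<tau> x))) \<le> ereal \<epsilon>"
    \<comment> \<open>Each of the two almost periods may be off by l, so their difference is off by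
      at most 2l.\<close>
    proof (intro exI[of _ "2 * l"] conjI ballI)
      show "0 < 2 * l" using \<open>0 < l\<close> by simp
      fix t\<^sub>0 assume "t\<^sub>0 \<in> differences \<Lambda>'"
      then obtain a b where ab: "a \<in> \<Lambda>'" "b \<in> \<Lambda>'" "t\<^sub>0 = a - b" by (auto simp: differences_def)
      \<comment> \<open>The bound on the supremum is read as a bound for every x in B. The
        selections found here and for b may be different, which \<open>key\<close> permits.\<close>
      obtain \<tau>\<^sub>1 y\<^sub>1 where 1: "\<tau>\<^sub>1 \<in> cball a l \<inter> \<Lambda>'" "\<forall>t\<in>\<Lambda>. \<forall>x\<in>B. y\<^sub>1 t x \<in> \<rho> `` {F t x}"
        "\<And>x. x \<in> B \<Longrightarrow> weighted_deviation \<Lambda> \<phi> \<F> F y\<^sub>1 \<tau>\<^sub>1 x \<in> P"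
        "\<And>x. x \<in> B \<Longrightarrow> pnorm \<Lambda> d (weighted_deviation \<Lambda> \<phi> \<F> F y\<^sub>1 \<tau>\<^sub>1 x) \<le> \<delta>"
        using bspec[OF l ab(1)] by (auto simp: SUP_le_iff)
      obtain \<tau>\<^sub>2 y\<^sub>2 where 2: "\<tau>\<^sub>2 \<in> cball b l \<inter> \<Lambda>'" "\<forall>t\<in>\<Lambda>. \<forall>x\<in>B. y\<^sub>2 t x \<in> \<rho> `` {F t x}"
        "\<And>x. x \<in> B \<Longrightarrow> weighted_deviation \<Lambda> \<phi> \<F> F y\<^sub>2 \<tau>\<^sub>2 x \<in> P"
        "\<And>x. x \<in> B \<Longrightarrow> pnorm \<Lambda> d (weighted_deviation \<Lambda> \<phi> \<F> F y\<^sub>2 \<tau>\<^sub>2 x) \<le> \<delta>"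
        using bspec[OF l ab(2)] by (auto simp: SUP_le_iff)
      have dev: "weighted_deviation \<Lambda> \<phi> \<G> F F (\<tau>\<^sub>1 - \<tau>\<^sub>2) x \<in> P\<^sub>1 \<and>
          pnorm \<Lambda> d\<^sub>1 (weighted_deviation \<Lambda> \<phi> \<G> F F (\<tau>\<^sub>1 - \<tau>\<^sub>2) x) \<le> \<epsilon>" if x: "x \<in> B" for x
      proof -
        have "K * (pnorm \<Lambda> d (weighted_deviation \<Lambda> \<phi> \<F> F y\<^sub>1 \<tau>\<^sub>1 x) +
            pnorm \<Lambda> d (weighted_deviation \<Lambda> \<phi> \<F> F y\<^sub>2 \<tau>\<^sub>2 x)) \<le> K * (\<delta> + \<delta>)"
          using 1(4) 2(4) x K by (intro mult_left_mono add_mono) auto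
        also have "\<dots> = \<epsilon>" using K by (simp add: \<delta>_def)
        finally show ?thesis using key[of \<tau>\<^sub>1 \<tau>\<^sub>2 y\<^sub>1 x y\<^sub>2] 1 2 x by force
      qed
      \<comment> \<open>The relation \<open>Id\<close> leaves F itself as the only selection on
        \<Lambda> and B.\<close>
      show "\<exists>\<tau> \<in> cball t\<^sub>0 (2 * l) \<inter> differences \<Lambda>'. \<exists>y.
          (\<forall>t\<in>\<Lambda>. \<forall>x\<in>B. y t x \<in> Id `` {F t x}) \<and>
          (\<forall>x\<in>B. weighted_deviation \<Lambda> \<phi> \<G> F y \<tau> x \<in> P\<^sub>1) \<and>
          (SUP x\<in>B. ereal (pnorm \<Lambda> d\<^sub>1 (weighted_deviation \<Lambda> \<phi> \<G> F y \<tau> x))) \<le> ereal \<epsilon>"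
        using dev differences_near[OF ab(1,2) 1(1) 2(1)]
        by (intro bexI[of _ "\<tau>\<^sub>1 - \<tau>\<^sub>2"] exI[of _ F]) (auto simp: ab(3) SUP_le_iff)
    qed
  qed
  have recurrent: "uniformly_recurrent \<Lambda> \<phi> \<G> \<B> (differences \<Lambda>') Id P\<^sub>1 d\<^sub>1 F"
    if ur: "uniformly_recurrent \<Lambda> \<phi> \<F> \<B> \<Lambda>' \<rho> P d F"
    unfolding uniformly_recurrent_def
  proof
    fix B assume B: "B \<in> \<B>"
    from ur[unfolded uniformly_recurrent_def, rule_format, OF B]
    obtain \<tau> :: "nat \<Rightarrow> real^'n" and y where \<tau>: "\<forall>k. \<tau> k \<in> \<Lambda>'"
        "filterlim (\<lambda>k. norm (\<tau> k)) at_top sequentially"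
      and y: "\<forall>t\<in>\<Lambda>. \<forall>x\<in>B. y t x \<in> \<rho> `` {F t x}"
        "\<forall>k. \<forall>x\<in>B. weighted_deviation \<Lambda> \<phi> \<F> F y (\<tau> k) x \<in> P"
      and lim: "(\<lambda>k. SUP x\<in>B. ereal (pnorm \<Lambda> d (weighted_deviation \<Lambda> \<phi> \<F> F y (\<tau> k) x))) \<longlonglongrightarrow> 0"
      by (elim exE conjE) (rule that)
    obtain m where m: "\<And>k. k \<le> m k"
        "filterlim (\<lambda>k. norm (\<tau> (m k) - \<tau> k)) at_top sequentially"
      using divergent_differences[OF \<tau>(2)] by blast
    let ?D = "\<lambda>k. weighted_deviation \<Lambda> \<phi> \<G> F F (\<tau> (m k) - \<tau> k)"
    let ?p = "\<lambda>k x. pnorm \<Lambda> d (weighted_deviation \<Lambda> \<phi> \<F> F y (\<tau> k) x)"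
    \<comment> \<open>Uniform recurrence has one selection for the whole sequence, so
      \<open>key\<close> is applied with y in both places.\<close>
    have dev: "?D k x \<in> P\<^sub>1 \<and> pnorm \<Lambda> d\<^sub>1 (?D k x) \<le> K * (?p (m k) x + ?p k x)" if "x \<in> B" for k x
      using that y \<tau>(1) by (intro key) auto
    have small: "\<forall>\<epsilon>>0. \<exists>N. \<forall>k\<ge>N. \<forall>x\<in>B. ?p k x \<le> \<epsilon>"
      using lim SUP_ereal_tendsto_0_iff[OF family(2)[OF B], of ?p] y(2) pnorm_nonneg[OF space_P] by blast
    have "\<forall>\<epsilon>>0. \<exists>N. \<forall>k\<ge>N. \<forall>x\<in>B. pnorm \<Lambda> d\<^sub>1 (?D k x) \<le> \<epsilon>"
    proof (intro allI impI)
      fix \<epsilon> :: real assume "0 < \<epsilon>"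
      then have "0 < \<epsilon> / (2 * K)" using K by simp
      with small obtain N where N: "\<And>k x. k \<ge> N \<Longrightarrow> x \<in> B \<Longrightarrow> ?p k x \<le> \<epsilon> / (2 * K)" by blast
      have "pnorm \<Lambda> d\<^sub>1 (?D k x) \<le> \<epsilon>" if "k \<ge> N" "x \<in> B" for k x
      proof -
        have "pnorm \<Lambda> d\<^sub>1 (?D k x) \<le> K * (?p (m k) x + ?p k x)" using dev[OF that(2)] by blast
        \<comment> \<open>The index \<open>m k\<close> is also at least N, because k is at least N
          and \<open>k \<le> m k\<close>; hence both terms are small.\<close>
        also have "\<dots> \<le> K * (\<epsilon> / (2 * K) + \<epsilon> / (2 * K))"
          using K N[OF order_trans[OF that(1) m(1)] that(2)] N[OF that]
          by (intro mult_left_mono add_mono) auto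
        also have "\<dots> = \<epsilon>" using K by simp
        finally show ?thesis .
      qed
      then show "\<exists>N. \<forall>k\<ge>N. \<forall>x\<in>B. pnorm \<Lambda> d\<^sub>1 (?D k x) \<le> \<epsilon>" by blast
    qed
    then have "(\<lambda>k. SUP x\<in>B. ereal (pnorm \<Lambda> d\<^sub>1 (?D k x))) \<longlonglongrightarrow> 0"
      using SUP_ereal_tendsto_0_iff[OF family(2)[OF B], of "\<lambda>k x. pnorm \<Lambda> d\<^sub>1 (?D k x)"]
        dev pnorm_nonneg[OF cond_P(1)] by blast
    moreover have "\<tau> (m k) - \<tau> k \<in> differences \<Lambda>'" for k using \<tau>(1) by (auto simp: differences_def)
    ultimately show "\<exists>\<tau> :: nat \<Rightarrow> real^'n.
      (\<forall>k. \<tau> k \<in> differences \<Lambda>') \<and> filterlim (\<lambda>k. norm (\<tau> k)) at_top sequentially \<and>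
      (\<exists>y. (\<forall>t\<in>\<Lambda>. \<forall>x\<in>B. y t x \<in> Id `` {F t x}) \<and>
        (\<forall>k. \<forall>x\<in>B. weighted_deviation \<Lambda> \<phi> \<G> F y (\<tau> k) x \<in> P\<^sub>1) \<and>
        (\<lambda>k. SUP x\<in>B. ereal (pnorm \<Lambda> d\<^sub>1 (weighted_deviation \<Lambda> \<phi> \<G> F y (\<tau> k) x))) \<longlonglongrightarrow> 0)"
      using m(2) dev by (intro exI[of _ "\<lambda>k. \<tau> (m k) - \<tau> k"] conjI exI[of _ F]) auto
  qed
  show ?thesis using bohr recurrent plus_differences_subset[OF translate_eq] by blast
qed

end
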